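(* Let $k$ be a field, $\mathcal{T}$ a Krull-Schmidt, $k$-linear, Hom-finite triangulated category, and let $T$ be a basic silting object of $\mathcal{T}$. Then any presilting object $U$ of $\mathcal{T}$ satisfying $T[-1]\geq U\geq T$ is partial silting.
   Context: Hom-finite means $\dim_k\operatorname{Hom}_{\mathcal{T}}(X,Y)<\infty$ for all objects $X,Y$. $\operatorname{thick} T$ is the smallest thick subcategory of $\mathcal{T}$ containing $T$. An object is basic if its endomorphism algebra is basic. An object $T$ of $\mathcal{T}$ is presilting if $\operatorname{Hom}_{\mathcal{T}}(T,T[i])=0$ for all $i>0$; it is silting if it is presilting and $\mathcal{T}=\operatorname{thick} T$; it is partial silting if it is a direct summand of a silting object. For objects $M,N$ of $\mathcal{T}$, $M\geq N$ means $\operatorname{Hom}_{\mathcal{T}}(M,N[i])=0$ for all $i>0$. *)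

theory Defs
  imports "HOL-Algebra.Module"
begin

section \<open>Finite-dimensional, local and basic algebras\<close>

definition finite_dimensional :: "('k, 'r) ring_scheme \<Rightarrow> ('k, 'm, 'z) module_scheme \<Rightarrow> bool" where
  "finite_dimensional K M \<longleftrightarrow>
     (\<exists>B. finite B \<and> B \<subseteq> carrier M \<and>
        (\<forall>x \<in> carrier M. \<exists>c \<in> B \<rightarrow> carrier K. x = (\<Oplus>\<^bsub>M\<^esub>b\<in>B. c b \<odot>\<^bsub>M\<^esub> b)))"

text \<open>Rings are not assumed commutative here; \<open>local_ring\<close> is the condition that the ring is
  nonzero and the sum of two non-units is a non-unit.\<close>

definition local_ring :: "('a, 'z) ring_scheme \<Rightarrow> bool" where
  "local_ring A \<longleftrightarrow> ring A \<and> \<one>\<^bsub>A\<^esub> \<noteq> \<zero>\<^bsub>A\<^esub> \<and>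
     (\<forall>a \<in> carrier A - Units A. \<forall>b \<in> carrier A - Units A. a \<oplus>\<^bsub>A\<^esub> b \<notin> Units A)"

definition idempotent :: "('a, 'z) ring_scheme \<Rightarrow> 'a \<Rightarrow> bool" where
  "idempotent A e \<longleftrightarrow> e \<in> carrier A \<and> e \<otimes>\<^bsub>A\<^esub> e = e"

definition orthogonal :: "('a, 'z) ring_scheme \<Rightarrow> 'a \<Rightarrow> 'a \<Rightarrow> bool" where
  "orthogonal A e f \<longleftrightarrow> e \<otimes>\<^bsub>A\<^esub> f = \<zero>\<^bsub>A\<^esub> \<and> f \<otimes>\<^bsub>A\<^esub> e = \<zero>\<^bsub>A\<^esub>"

definition primitive_idempotent :: "('a, 'z) ring_scheme \<Rightarrow> 'a \<Rightarrow> bool" where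
  "primitive_idempotent A e \<longleftrightarrow> idempotent A e \<and> e \<noteq> \<zero>\<^bsub>A\<^esub> \<and>
     (\<forall>e1 e2. idempotent A e1 \<and> idempotent A e2 \<and> orthogonal A e1 e2 \<and> e = e1 \<oplus>\<^bsub>A\<^esub> e2
        \<longrightarrow> e1 = \<zero>\<^bsub>A\<^esub> \<or> e2 = \<zero>\<^bsub>A\<^esub>)"

definition complete_primitive_orthogonal_idempotents :: "('a, 'z) ring_scheme \<Rightarrow> 'a set \<Rightarrow> bool" where
  "complete_primitive_orthogonal_idempotents A E \<longleftrightarrow>
     finite E \<and> (\<forall>e \<in> E. primitive_idempotent A e) \<and>
     (\<forall>e \<in> E. \<forall>f \<in> E. e \<noteq> f \<longrightarrow> orthogonal A e f) \<and>
     (\<Oplus>\<^bsub>A\<^esub>e\<in>E. e) = \<one>\<^bsub>A\<^esub>"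

definition principal_right_ideal :: "('a, 'z) ring_scheme \<Rightarrow> 'a \<Rightarrow> 'a set" where
  "principal_right_ideal A e = (\<lambda>a. e \<otimes>\<^bsub>A\<^esub> a) ` carrier A"

definition iso_right_ideals :: "('a, 'z) ring_scheme \<Rightarrow> 'a set \<Rightarrow> 'a set \<Rightarrow> bool" where
  "iso_right_ideals A I J \<longleftrightarrow>
     (\<exists>\<phi>. bij_betw \<phi> I J \<and>
        (\<forall>x \<in> I. \<forall>y \<in> I. \<phi> (x \<oplus>\<^bsub>A\<^esub> y) = \<phi> x \<oplus>\<^bsub>A\<^esub> \<phi> y) \<and>
        (\<forall>x \<in> I. \<forall>a \<in> carrier A. \<phi> (x \<otimes>\<^bsub>A\<^esub> a) = \<phi> x \<otimes>\<^bsub>A\<^esub> a))"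

text \<open>A finite-dimensional algebra is basic if, for a complete set of primitive orthogonal
  idempotents \<open>e\<^sub>1, \<dots>, e\<^sub>n\<close>, the indecomposable projective right modules \<open>e\<^sub>i A\<close> are pairwise
  non-isomorphic. The zero algebra is basic (\<open>n = 0\<close>).\<close>

definition basic_algebra :: "('a, 'z) ring_scheme \<Rightarrow> bool" where
  "basic_algebra A \<longleftrightarrow> ring A \<and>
     (\<exists>E. complete_primitive_orthogonal_idempotents A E \<and>
        (\<forall>e \<in> E. \<forall>f \<in> E. e \<noteq> f \<longrightarrow>
           \<not> iso_right_ideals A (principal_right_ideal A e) (principal_right_ideal A f)))"


section \<open>Linear categories\<close>

text \<open>The objects are the elements of the type \<open>'o\<close>. Each \<open>Hom C X Y\<close> is a module record whose
  carrier is the set of morphisms from \<open>X\<close> to \<open>Y\<close>; its ring fields \<open>mult\<close> and \<open>one\<close> carry no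
  meaning. \<open>g \<cdot> f\<close> is first \<open>f\<close>, then \<open>g\<close>. As composition does not mention objects, the intended
  encoding has morphisms that know their source and target, but disjointness of the
  Hom-sets is not required.\<close>

record ('k, 'o, 'm) linear_cat =
  Hom :: "'o \<Rightarrow> 'o \<Rightarrow> ('k, 'm) module"
  compose :: "'m \<Rightarrow> 'm \<Rightarrow> 'm" (infixl "\<cdot>\<index>" 70)
  ident :: "'o \<Rightarrow> 'm"

abbreviation mor :: "('k, 'o, 'm, 'z) linear_cat_scheme \<Rightarrow> 'o \<Rightarrow> 'o \<Rightarrow> 'm set" where
  "mor C X Y \<equiv> carrier (Hom C X Y)"

locale linear_category = field K for K :: "('k, 'r) ring_scheme" +
  fixes C :: "('k, 'o, 'm, 'z) linear_cat_scheme"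
  assumes hom_module: "module K (Hom C X Y)"
    and ident_mor: "ident C X \<in> mor C X X"
    and comp_mor: "\<lbrakk>f \<in> mor C X Y; g \<in> mor C Y Z\<rbrakk> \<Longrightarrow> g \<cdot>\<^bsub>C\<^esub> f \<in> mor C X Z"
    and comp_assoc: "\<lbrakk>f \<in> mor C W X; g \<in> mor C X Y; h \<in> mor C Y Z\<rbrakk>
          \<Longrightarrow> (h \<cdot>\<^bsub>C\<^esub> g) \<cdot>\<^bsub>C\<^esub> f = h \<cdot>\<^bsub>C\<^esub> (g \<cdot>\<^bsub>C\<^esub> f)"
    and comp_ident_right: "f \<in> mor C X Y \<Longrightarrow> f \<cdot>\<^bsub>C\<^esub> ident C X = f"
    and comp_ident_left: "f \<in> mor C X Y \<Longrightarrow> ident C Y \<cdot>\<^bsub>C\<^esub> f = f"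
    and comp_add_right: "\<lbrakk>f \<in> mor C X Y; f' \<in> mor C X Y; g \<in> mor C Y Z\<rbrakk>
          \<Longrightarrow> g \<cdot>\<^bsub>C\<^esub> (f \<oplus>\<^bsub>Hom C X Y\<^esub> f') = (g \<cdot>\<^bsub>C\<^esub> f) \<oplus>\<^bsub>Hom C X Z\<^esub> (g \<cdot>\<^bsub>C\<^esub> f')"
    and comp_add_left: "\<lbrakk>f \<in> mor C X Y; g \<in> mor C Y Z; g' \<in> mor C Y Z\<rbrakk>
          \<Longrightarrow> (g \<oplus>\<^bsub>Hom C Y Z\<^esub> g') \<cdot>\<^bsub>C\<^esub> f = (g \<cdot>\<^bsub>C\<^esub> f) \<oplus>\<^bsub>Hom C X Z\<^esub> (g' \<cdot>\<^bsub>C\<^esub> f)"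
    and comp_smult_right: "\<lbrakk>r \<in> carrier K; f \<in> mor C X Y; g \<in> mor C Y Z\<rbrakk>
          \<Longrightarrow> g \<cdot>\<^bsub>C\<^esub> (r \<odot>\<^bsub>Hom C X Y\<^esub> f) = r \<odot>\<^bsub>Hom C X Z\<^esub> (g \<cdot>\<^bsub>C\<^esub> f)"
    and comp_smult_left: "\<lbrakk>r \<in> carrier K; f \<in> mor C X Y; g \<in> mor C Y Z\<rbrakk>
          \<Longrightarrow> (r \<odot>\<^bsub>Hom C Y Z\<^esub> g) \<cdot>\<^bsub>C\<^esub> f = r \<odot>\<^bsub>Hom C X Z\<^esub> (g \<cdot>\<^bsub>C\<^esub> f)"

definition End_algebra :: "('k, 'o, 'm, 'z) linear_cat_scheme \<Rightarrow> 'o \<Rightarrow> ('k, 'm) module" where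
  "End_algebra C X = (Hom C X X)\<lparr>mult := compose C, one := ident C X\<rparr>"

definition hom_finite ::
  "('k, 'r) ring_scheme \<Rightarrow> ('k, 'o, 'm, 'z) linear_cat_scheme \<Rightarrow> bool" where
  "hom_finite K C \<longleftrightarrow> (\<forall>X Y. finite_dimensional K (Hom C X Y))"

definition is_iso :: "('k, 'o, 'm, 'z) linear_cat_scheme \<Rightarrow> 'o \<Rightarrow> 'o \<Rightarrow> 'm \<Rightarrow> bool" where
  "is_iso C X Y f \<longleftrightarrow> f \<in> mor C X Y \<and>
     (\<exists>g \<in> mor C Y X. g \<cdot>\<^bsub>C\<^esub> f = ident C X \<and> f \<cdot>\<^bsub>C\<^esub> g = ident C Y)"

definition zero_object :: "('k, 'o, 'm, 'z) linear_cat_scheme \<Rightarrow> 'o \<Rightarrow> bool" where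
  "zero_object C Z \<longleftrightarrow>
     (\<forall>X. mor C Z X = {\<zero>\<^bsub>Hom C Z X\<^esub>} \<and> mor C X Z = {\<zero>\<^bsub>Hom C X Z\<^esub>})"

text \<open>\<open>S\<close> is a direct sum (biproduct) of the finite family \<open>Xs\<close>, for some choice of inclusions and
  projections. Direct sums of the empty family are exactly the zero objects.\<close>

definition is_direct_sum :: "('k, 'o, 'm, 'z) linear_cat_scheme \<Rightarrow> 'o \<Rightarrow> 'o list \<Rightarrow> bool" where
  "is_direct_sum C S Xs \<longleftrightarrow>
     (\<exists>\<iota> \<pi>.
        (\<forall>i < length Xs. \<iota> i \<in> mor C (Xs ! i) S \<and> \<pi> i \<in> mor C S (Xs ! i)) \<and>
        (\<forall>i < length Xs. \<forall>j < length Xs.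
           \<pi> j \<cdot>\<^bsub>C\<^esub> \<iota> i = (if i = j then ident C (Xs ! i) else \<zero>\<^bsub>Hom C (Xs ! i) (Xs ! j)\<^esub>)) \<and>
        ident C S = (\<Oplus>\<^bsub>Hom C S S\<^esub>i\<in>{..<length Xs}. \<iota> i \<cdot>\<^bsub>C\<^esub> \<pi> i))"

definition direct_summand :: "('k, 'o, 'm, 'z) linear_cat_scheme \<Rightarrow> 'o \<Rightarrow> 'o \<Rightarrow> bool" where
  "direct_summand C X S \<longleftrightarrow> (\<exists>Y. is_direct_sum C S [X, Y])"

definition krull_schmidt :: "('k, 'o, 'm, 'z) linear_cat_scheme \<Rightarrow> bool" where
  "krull_schmidt C \<longleftrightarrow>
     (\<forall>X. \<exists>Xs. is_direct_sum C X Xs \<and> (\<forall>Y \<in> set Xs. local_ring (End_algebra C Y)))"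

definition basic_object :: "('k, 'o, 'm, 'z) linear_cat_scheme \<Rightarrow> 'o \<Rightarrow> bool" where
  "basic_object C X \<longleftrightarrow> basic_algebra (End_algebra C X)"


section \<open>Triangulated categories\<close>

text \<open>\<open>shift_ob\<close> and \<open>shift_mor\<close> are the action of the translation functor \<open>[1]\<close>, which is an
  automorphism of the category. \<open>Tri C X Y Z f g h\<close> says that
  \<open>X \<rightarrow> Y \<rightarrow> Z \<rightarrow> X[1]\<close>, with maps \<open>f\<close>, \<open>g\<close>, \<open>h\<close>, is a distinguished triangle.\<close>

record ('k, 'o, 'm) triangulated_cat = "('k, 'o, 'm) linear_cat" +
  shift_ob :: "'o \<Rightarrow> 'o"
  shift_mor :: "'m \<Rightarrow> 'm"
  Tri :: "'o \<Rightarrow> 'o \<Rightarrow> 'o \<Rightarrow> 'm \<Rightarrow> 'm \<Rightarrow> 'm \<Rightarrow> bool"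

locale triangulated_category = linear_category K C
  for K :: "('k, 'r) ring_scheme" and C :: "('k, 'o, 'm, 'z) triangulated_cat_scheme" +
  assumes zero_object_exists: "\<exists>Z. zero_object C Z"
    and direct_sum_exists: "\<exists>S. is_direct_sum C S [X, Y]"
    and shift_ob_bij: "bij (shift_ob C)"
    and shift_mor_bij:
      "bij_betw (shift_mor C) (mor C X Y) (mor C (shift_ob C X) (shift_ob C Y))"
    and shift_ident: "shift_mor C (ident C X) = ident C (shift_ob C X)"
    and shift_comp: "\<lbrakk>f \<in> mor C X Y; g \<in> mor C Y Z\<rbrakk>
          \<Longrightarrow> shift_mor C (g \<cdot>\<^bsub>C\<^esub> f) = shift_mor C g \<cdot>\<^bsub>C\<^esub> shift_mor C f"
    and shift_add: "\<lbrakk>f \<in> mor C X Y; g \<in> mor C X Y\<rbrakk>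
          \<Longrightarrow> shift_mor C (f \<oplus>\<^bsub>Hom C X Y\<^esub> g)
            = shift_mor C f \<oplus>\<^bsub>Hom C (shift_ob C X) (shift_ob C Y)\<^esub> shift_mor C g"
    and shift_smult: "\<lbrakk>r \<in> carrier K; f \<in> mor C X Y\<rbrakk>
          \<Longrightarrow> shift_mor C (r \<odot>\<^bsub>Hom C X Y\<^esub> f)
            = r \<odot>\<^bsub>Hom C (shift_ob C X) (shift_ob C Y)\<^esub> shift_mor C f"
    and Tri_mor: "Tri C X Y Z f g h
          \<Longrightarrow> f \<in> mor C X Y \<and> g \<in> mor C Y Z \<and> h \<in> mor C Z (shift_ob C X)"
    and TR1_iso: "\<lbrakk>Tri C X Y Z f g h; is_iso C X X' a; is_iso C Y Y' b; is_iso C Z Z' c;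
          f' \<in> mor C X' Y'; g' \<in> mor C Y' Z'; h' \<in> mor C Z' (shift_ob C X');
          b \<cdot>\<^bsub>C\<^esub> f = f' \<cdot>\<^bsub>C\<^esub> a; c \<cdot>\<^bsub>C\<^esub> g = g' \<cdot>\<^bsub>C\<^esub> b; shift_mor C a \<cdot>\<^bsub>C\<^esub> h = h' \<cdot>\<^bsub>C\<^esub> c\<rbrakk>
          \<Longrightarrow> Tri C X' Y' Z' f' g' h'"
    and TR1_ident: "zero_object C Z
          \<Longrightarrow> Tri C X X Z (ident C X) \<zero>\<^bsub>Hom C X Z\<^esub> \<zero>\<^bsub>Hom C Z (shift_ob C X)\<^esub>"
    and TR1_cone: "f \<in> mor C X Y \<Longrightarrow> \<exists>Z g h. Tri C X Y Z f g h"
    and TR2: "\<lbrakk>f \<in> mor C X Y; g \<in> mor C Y Z; h \<in> mor C Z (shift_ob C X)\<rbrakk>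
          \<Longrightarrow> Tri C X Y Z f g h \<longleftrightarrow>
            Tri C Y Z (shift_ob C X) g h
              (\<ominus>\<^bsub>Hom C (shift_ob C X) (shift_ob C Y)\<^esub> shift_mor C f)"
    and TR3: "\<lbrakk>Tri C X Y Z f g h; Tri C X' Y' Z' f' g' h'; a \<in> mor C X X'; b \<in> mor C Y Y';
          b \<cdot>\<^bsub>C\<^esub> f = f' \<cdot>\<^bsub>C\<^esub> a\<rbrakk>
          \<Longrightarrow> \<exists>c \<in> mor C Z Z'. c \<cdot>\<^bsub>C\<^esub> g = g' \<cdot>\<^bsub>C\<^esub> b \<and> shift_mor C a \<cdot>\<^bsub>C\<^esub> h = h' \<cdot>\<^bsub>C\<^esub> c"
    and TR4: "\<lbrakk>Tri C X Y P f a b; Tri C Y Z Q g c d; Tri C X Z R (g \<cdot>\<^bsub>C\<^esub> f) e h\<rbrakk>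
          \<Longrightarrow> \<exists>u v. Tri C P R Q u v (shift_mor C a \<cdot>\<^bsub>C\<^esub> d) \<and>
            u \<cdot>\<^bsub>C\<^esub> a = e \<cdot>\<^bsub>C\<^esub> g \<and> h \<cdot>\<^bsub>C\<^esub> u = b \<and> v \<cdot>\<^bsub>C\<^esub> e = c \<and> d \<cdot>\<^bsub>C\<^esub> v = shift_mor C f \<cdot>\<^bsub>C\<^esub> h"

definition shift :: "('k, 'o, 'm, 'z) triangulated_cat_scheme \<Rightarrow> int \<Rightarrow> 'o \<Rightarrow> 'o" where
  "shift C i X = (if i \<ge> 0 then (shift_ob C ^^ nat i) X
                  else (inv_into UNIV (shift_ob C) ^^ nat (- i)) X)"

text \<open>A thick subcategory (full triangulated subcategory closed under direct summands) is given by
  its set of objects. Closure under isomorphism is the case of a zero complement in the last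
  clause.\<close>

definition thick_subcategory :: "('k, 'o, 'm, 'z) triangulated_cat_scheme \<Rightarrow> 'o set \<Rightarrow> bool" where
  "thick_subcategory C \<S> \<longleftrightarrow>
     (\<forall>Z. zero_object C Z \<longrightarrow> Z \<in> \<S>) \<and>
     (\<forall>X \<in> \<S>. shift C 1 X \<in> \<S> \<and> shift C (-1) X \<in> \<S>) \<and>
     (\<forall>X Y Z f g h. Tri C X Y Z f g h \<and> X \<in> \<S> \<and> Y \<in> \<S> \<longrightarrow> Z \<in> \<S>) \<and>
     (\<forall>X S. S \<in> \<S> \<and> direct_summand C X S \<longrightarrow> X \<in> \<S>)"

definition thick :: "('k, 'o, 'm, 'z) triangulated_cat_scheme \<Rightarrow> 'o \<Rightarrow> 'o set" where
  "thick C T = \<Inter> {\<S>. thick_subcategory C \<S> \<and> T \<in> \<S>}"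


section \<open>Silting objects\<close>

definition silting_geq :: "('k, 'o, 'm, 'z) triangulated_cat_scheme \<Rightarrow> 'o \<Rightarrow> 'o \<Rightarrow> bool" where
  "silting_geq C M N \<longleftrightarrow> (\<forall>i > 0. mor C M (shift C i N) = {\<zero>\<^bsub>Hom C M (shift C i N)\<^esub>})"

definition presilting :: "('k, 'o, 'm, 'z) triangulated_cat_scheme \<Rightarrow> 'o \<Rightarrow> bool" where
  "presilting C T \<longleftrightarrow> (\<forall>i > 0. mor C T (shift C i T) = {\<zero>\<^bsub>Hom C T (shift C i T)\<^esub>})"

definition silting :: "('k, 'o, 'm, 'z) triangulated_cat_scheme \<Rightarrow> 'o \<Rightarrow> bool" where
  "silting C T \<longleftrightarrow> presilting C T \<and> thick C T = UNIV"

definition partial_silting :: "('k, 'o, 'm, 'z) triangulated_cat_scheme \<Rightarrow> 'o \<Rightarrow> bool" where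
  "partial_silting C U \<longleftrightarrow> (\<exists>S. silting C S \<and> direct_summand C U S)"

end

theory Submission
  imports Defs
begin

text \<open>Put \<open>S = T[-1]\<close>. This is silting, and \<open>T[-1] \<ge> U \<ge> T\<close> says \<open>S \<ge> U \<ge> S[1]\<close>, so \<open>U\<close> is a two-term
  object for \<open>S\<close> and a complement comes from Bongartz's construction: extend \<open>S\<close> by copies of \<open>U\<close>
  until the result \<open>X\<close> satisfies \<open>Hom(U, X[1]) = 0\<close>, and take \<open>U \<oplus> X\<close>.

  The classical construction uses one triangle \<open>S \<rightarrow> X \<rightarrow> U\<^sup>n \<rightarrow> S[1]\<close> over a universal map. Here the
  copies of \<open>U\<close> are attached one at a time, each killing one of finitely many generators of
  \<open>Hom(U, S[1])\<close> (lemma \<open>iterated_extension_killing_maps\<close>). As \<open>Hom(U, U[1]) = 0\<close>, no step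
  creates new maps, so once the generators are dead nothing is left.

  All other vanishing in \<open>U \<oplus> X\<close> is devissage, since \<open>X\<close> is filtered by \<open>S\<close> and copies of \<open>U\<close>.
  The condition \<open>S \<ge> U\<close> gives \<open>S \<ge> X\<close>; the condition \<open>U \<ge> S[1]\<close> gives \<open>Hom(U, X[i]) = 0\<close> for
  \<open>i \<ge> 2\<close>, hence \<open>U \<ge> X\<close>; filtering \<open>X\<close> in the first argument then gives \<open>X \<ge> X\<close> and \<open>X \<ge> U\<close>.
  Undoing the extensions recovers \<open>S\<close> from \<open>X\<close> and \<open>U\<close>, so \<open>U \<oplus> X\<close> generates whatever \<open>S\<close>
  generates.\<close>


section \<open>Zero morphisms in a linear category\<close>

context linear_category
begin

lemma hom_group: "abelian_group (Hom C X Y)"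
  using hom_module by (rule module.axioms(2))

lemma zero_mor: "\<zero>\<^bsub>Hom C X Y\<^esub> \<in> mor C X Y"
  by (rule abelian_monoid.zero_closed[OF abelian_group.axioms(1)[OF hom_group]])

lemma neg_mor: "f \<in> mor C X Y \<Longrightarrow> \<ominus>\<^bsub>Hom C X Y\<^esub> f \<in> mor C X Y"
  by (rule abelian_group.a_inv_closed[OF hom_group])

lemma neg_neg_mor: "f \<in> mor C X Y \<Longrightarrow> \<ominus>\<^bsub>Hom C X Y\<^esub> (\<ominus>\<^bsub>Hom C X Y\<^esub> f) = f"
  by (rule abelian_group.minus_minus[OF hom_group])

lemma add_zero: "f \<in> mor C X Y \<Longrightarrow> \<zero>\<^bsub>Hom C X Y\<^esub> \<oplus>\<^bsub>Hom C X Y\<^esub> f = f"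
  by (rule abelian_monoid.l_zero[OF abelian_group.axioms(1)[OF hom_group]])

lemma add_commute:
  "f \<in> mor C X Y \<Longrightarrow> g \<in> mor C X Y \<Longrightarrow> f \<oplus>\<^bsub>Hom C X Y\<^esub> g = g \<oplus>\<^bsub>Hom C X Y\<^esub> f"
  by (rule abelian_monoid.a_comm[OF abelian_group.axioms(1)[OF hom_group]])

lemma add_neg:
  "f \<in> mor C X Y \<Longrightarrow> f \<oplus>\<^bsub>Hom C X Y\<^esub> \<ominus>\<^bsub>Hom C X Y\<^esub> f = \<zero>\<^bsub>Hom C X Y\<^esub>"
  by (rule abelian_group.r_neg[OF hom_group])

lemma neg_inj:
  assumes "f \<in> mor C X Y" "g \<in> mor C X Y" "\<ominus>\<^bsub>Hom C X Y\<^esub> f = \<ominus>\<^bsub>Hom C X Y\<^esub> g"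
  shows "f = g"
  by (rule inj_onD[OF abelian_group.a_inv_inj[OF hom_group] assms(3,1,2)])

lemma idempotent_add_zero:
  assumes "f \<in> mor C X Y" "f \<oplus>\<^bsub>Hom C X Y\<^esub> f = f"
  shows "f = \<zero>\<^bsub>Hom C X Y\<^esub>"
  using abelian_group.r_neg1[OF hom_group assms(1,1)] assms
  by (simp add: add_commute[OF neg_mor[OF assms(1)] assms(1)] add_neg)

lemma neg_unique:
  assumes "f \<in> mor C X Y" "g \<in> mor C X Y" "f \<oplus>\<^bsub>Hom C X Y\<^esub> g = \<zero>\<^bsub>Hom C X Y\<^esub>"
  shows "g = \<ominus>\<^bsub>Hom C X Y\<^esub> f"
  using assms abelian_group.minus_equality[OF hom_group] add_commute by metis

lemma neg_zero: "\<ominus>\<^bsub>Hom C X Y\<^esub> \<zero>\<^bsub>Hom C X Y\<^esub> = \<zero>\<^bsub>Hom C X Y\<^esub>"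
  using neg_unique[OF zero_mor zero_mor add_zero[OF zero_mor]] by simp

lemma comp_zero_right:
  assumes "g \<in> mor C Y Z"
  shows "g \<cdot>\<^bsub>C\<^esub> \<zero>\<^bsub>Hom C X Y\<^esub> = \<zero>\<^bsub>Hom C X Z\<^esub>"
  using comp_add_right[OF zero_mor zero_mor assms]
  by (intro idempotent_add_zero comp_mor[OF zero_mor assms]) (simp add: add_zero zero_mor)

lemma comp_zero_left:
  assumes "f \<in> mor C X Y"
  shows "\<zero>\<^bsub>Hom C Y Z\<^esub> \<cdot>\<^bsub>C\<^esub> f = \<zero>\<^bsub>Hom C X Z\<^esub>"
  using comp_add_left[OF assms zero_mor zero_mor]
  by (intro idempotent_add_zero comp_mor[OF assms zero_mor]) (simp add: add_zero zero_mor)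

lemma comp_neg_right:
  assumes f: "f \<in> mor C X Y" and g: "g \<in> mor C Y Z"
  shows "g \<cdot>\<^bsub>C\<^esub> (\<ominus>\<^bsub>Hom C X Y\<^esub> f) = \<ominus>\<^bsub>Hom C X Z\<^esub> (g \<cdot>\<^bsub>C\<^esub> f)"
  using comp_add_right[OF f neg_mor[OF f] g]
  by (intro neg_unique comp_mor[OF f g] comp_mor[OF neg_mor[OF f] g])
    (simp add: add_neg[OF f] comp_zero_right[OF g])

lemma comp_neg_left:
  assumes f: "f \<in> mor C X Y" and g: "g \<in> mor C Y Z"
  shows "(\<ominus>\<^bsub>Hom C Y Z\<^esub> g) \<cdot>\<^bsub>C\<^esub> f = \<ominus>\<^bsub>Hom C X Z\<^esub> (g \<cdot>\<^bsub>C\<^esub> f)"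
  using comp_add_left[OF f g neg_mor[OF g]]
  by (intro neg_unique comp_mor[OF f g] comp_mor[OF f neg_mor[OF g]])
    (simp add: add_neg[OF g] comp_zero_left[OF f])

lemma neg_eq_zero:
  assumes "f \<in> mor C X Y" "\<ominus>\<^bsub>Hom C X Y\<^esub> f = \<zero>\<^bsub>Hom C X Y\<^esub>"
  shows "f = \<zero>\<^bsub>Hom C X Y\<^esub>"
  using assms neg_neg_mor neg_zero by metis

lemma smult_mor: "r \<in> carrier K \<Longrightarrow> f \<in> mor C X Y \<Longrightarrow> r \<odot>\<^bsub>Hom C X Y\<^esub> f \<in> mor C X Y"
  by (rule module.smult_closed[OF hom_module])

text \<open>The morphisms killed by \<open>g\<close> form a submodule, so \<open>g\<close> kills the span of whatever it
  kills.\<close>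

lemma comp_linear_combination_zero:
  assumes fin: "finite B" and B: "B \<subseteq> mor C X Y" and c: "c \<in> B \<rightarrow> carrier K"
    and g: "g \<in> mor C Y Z" and zero: "\<And>b. b \<in> B \<Longrightarrow> g \<cdot>\<^bsub>C\<^esub> b = \<zero>\<^bsub>Hom C X Z\<^esub>"
  shows "g \<cdot>\<^bsub>C\<^esub> (\<Oplus>\<^bsub>Hom C X Y\<^esub>b\<in>B. c b \<odot>\<^bsub>Hom C X Y\<^esub> b) = \<zero>\<^bsub>Hom C X Z\<^esub>"
  using fin B c zero
proof (induction B rule: finite_induct)
  case empty
  then show ?case
    using comp_zero_right[OF g]
    by (simp add: abelian_monoid.finsum_empty[OF abelian_group.axioms(1)[OF hom_group]])
next
  case (insert b B)
  interpret M: abelian_group "Hom C X Y" by (rule hom_group)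
  have b: "b \<in> mor C X Y" "c b \<in> carrier K" using insert.prems by auto
  have cl: "(\<lambda>b. c b \<odot>\<^bsub>Hom C X Y\<^esub> b) \<in> B \<rightarrow> mor C X Y"
    using insert.prems by (auto intro!: smult_mor)
  have "g \<cdot>\<^bsub>C\<^esub> (c b \<odot>\<^bsub>Hom C X Y\<^esub> b) = \<zero>\<^bsub>Hom C X Z\<^esub>"
    using comp_smult_right[OF b(2,1) g] insert.prems(3)[of b] b
      module.smult_r_null[OF hom_module] by simp
  moreover have "g \<cdot>\<^bsub>C\<^esub> (\<Oplus>\<^bsub>Hom C X Y\<^esub>b\<in>B. c b \<odot>\<^bsub>Hom C X Y\<^esub> b) = \<zero>\<^bsub>Hom C X Z\<^esub>"
    using insert.prems by (intro insert.IH) auto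
  ultimately show ?case
    using insert.hyps cl b g
    by (simp add: smult_mor comp_add_right M.finsum_closed add_zero zero_mor)
qed

end


section \<open>Vanishing of Hom spaces\<close>

definition no_maps :: "('k, 'o, 'm, 'z) linear_cat_scheme \<Rightarrow> 'o \<Rightarrow> 'o \<Rightarrow> bool" where
  "no_maps C A B \<longleftrightarrow> mor C A B = {\<zero>\<^bsub>Hom C A B\<^esub>}"

lemma no_mapsD: "no_maps C A B \<Longrightarrow> f \<in> mor C A B \<Longrightarrow> f = \<zero>\<^bsub>Hom C A B\<^esub>"
  by (auto simp: no_maps_def)

lemma (in linear_category) no_mapsI:
  assumes "\<And>f. f \<in> mor C A B \<Longrightarrow> f = \<zero>\<^bsub>Hom C A B\<^esub>"
  shows "no_maps C A B"
  unfolding no_maps_def using assms zero_mor by blast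

context linear_category
begin

lemma finsum_two:
  assumes "f (0::nat) \<in> mor C S S" "f 1 \<in> mor C S S"
  shows "(\<Oplus>\<^bsub>Hom C S S\<^esub>k\<in>{..<length [X, Y]}. f k) = f 0 \<oplus>\<^bsub>Hom C S S\<^esub> f 1"
proof -
  interpret M: abelian_group "Hom C S S" by (rule hom_group)
  have range: "{..<length [X, Y]} = {0, 1}" by auto
  show ?thesis
    unfolding range using assms by (simp add: M.finsum_insert)
qed

lemma direct_sum_two_cases:
  assumes "is_direct_sum C S [X, Y]"
  obtains i p j q where "i \<in> mor C X S" "p \<in> mor C S X" "j \<in> mor C Y S" "q \<in> mor C S Y"
    "p \<cdot>\<^bsub>C\<^esub> i = ident C X" "q \<cdot>\<^bsub>C\<^esub> j = ident C Y"
    "q \<cdot>\<^bsub>C\<^esub> i = \<zero>\<^bsub>Hom C X Y\<^esub>" "p \<cdot>\<^bsub>C\<^esub> j = \<zero>\<^bsub>Hom C Y X\<^esub>"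
    "ident C S = (i \<cdot>\<^bsub>C\<^esub> p) \<oplus>\<^bsub>Hom C S S\<^esub> (j \<cdot>\<^bsub>C\<^esub> q)"
proof -
  obtain \<iota> \<pi> where
    mors: "\<forall>i < length [X, Y]. \<iota> i \<in> mor C ([X, Y] ! i) S \<and> \<pi> i \<in> mor C S ([X, Y] ! i)"
    and ortho: "\<forall>i < length [X, Y]. \<forall>j < length [X, Y]. \<pi> j \<cdot>\<^bsub>C\<^esub> \<iota> i
      = (if i = j then ident C ([X, Y] ! i) else \<zero>\<^bsub>Hom C ([X, Y] ! i) ([X, Y] ! j)\<^esub>)"
    and sum: "ident C S = (\<Oplus>\<^bsub>Hom C S S\<^esub>i\<in>{..<length [X, Y]}. \<iota> i \<cdot>\<^bsub>C\<^esub> \<pi> i)"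
    using assms unfolding is_direct_sum_def by blast
  have m: "\<iota> 0 \<in> mor C X S" "\<pi> 0 \<in> mor C S X" "\<iota> 1 \<in> mor C Y S" "\<pi> 1 \<in> mor C S Y"
    using mors[rule_format, of 0] mors[rule_format, of 1] by simp_all
  have "ident C S = (\<iota> 0 \<cdot>\<^bsub>C\<^esub> \<pi> 0) \<oplus>\<^bsub>Hom C S S\<^esub> (\<iota> 1 \<cdot>\<^bsub>C\<^esub> \<pi> 1)"
    by (rule trans[OF sum finsum_two]) (rule comp_mor[OF m(2,1)] comp_mor[OF m(4,3)])+
  moreover have "\<pi> 0 \<cdot>\<^bsub>C\<^esub> \<iota> 0 = ident C X" "\<pi> 1 \<cdot>\<^bsub>C\<^esub> \<iota> 1 = ident C Y"
    "\<pi> 1 \<cdot>\<^bsub>C\<^esub> \<iota> 0 = \<zero>\<^bsub>Hom C X Y\<^esub>" "\<pi> 0 \<cdot>\<^bsub>C\<^esub> \<iota> 1 = \<zero>\<^bsub>Hom C Y X\<^esub>"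
    using ortho[rule_format, of 0 0] ortho[rule_format, of 1 1]
      ortho[rule_format, of 0 1] ortho[rule_format, of 1 0] by simp_all
  ultimately show thesis by (intro that[OF m])
qed

lemma direct_sum_twoI:
  assumes m: "i \<in> mor C X S" "p \<in> mor C S X" "j \<in> mor C Y S" "q \<in> mor C S Y"
    and ortho: "p \<cdot>\<^bsub>C\<^esub> i = ident C X" "q \<cdot>\<^bsub>C\<^esub> j = ident C Y"
      "q \<cdot>\<^bsub>C\<^esub> i = \<zero>\<^bsub>Hom C X Y\<^esub>" "p \<cdot>\<^bsub>C\<^esub> j = \<zero>\<^bsub>Hom C Y X\<^esub>"
    and sum: "ident C S = (i \<cdot>\<^bsub>C\<^esub> p) \<oplus>\<^bsub>Hom C S S\<^esub> (j \<cdot>\<^bsub>C\<^esub> q)"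
  shows "is_direct_sum C S [X, Y]"
proof -
  let ?\<iota> = "\<lambda>k::nat. if k = 0 then i else j" and ?\<pi> = "\<lambda>k::nat. if k = 0 then p else q"
  have fs: "(\<Oplus>\<^bsub>Hom C S S\<^esub>k\<in>{..<length [X, Y]}. ?\<iota> k \<cdot>\<^bsub>C\<^esub> ?\<pi> k)
      = (i \<cdot>\<^bsub>C\<^esub> p) \<oplus>\<^bsub>Hom C S S\<^esub> (j \<cdot>\<^bsub>C\<^esub> q)"
    using finsum_two[of "\<lambda>k. ?\<iota> k \<cdot>\<^bsub>C\<^esub> ?\<pi> k" S X Y] comp_mor[OF m(2,1)] comp_mor[OF m(4,3)]
    by simp
  have mors: "\<forall>k < length [X, Y]. ?\<iota> k \<in> mor C ([X, Y] ! k) S \<and> ?\<pi> k \<in> mor C S ([X, Y] ! k)"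
    using m by (auto simp: less_Suc_eq)
  have "\<forall>k < length [X, Y]. \<forall>l < length [X, Y]. ?\<pi> l \<cdot>\<^bsub>C\<^esub> ?\<iota> k
      = (if k = l then ident C ([X, Y] ! k) else \<zero>\<^bsub>Hom C ([X, Y] ! k) ([X, Y] ! l)\<^esub>)"
    using ortho by (auto simp: less_Suc_eq)
  then show ?thesis
    unfolding is_direct_sum_def using mors trans[OF sum fs[symmetric]]
    by (intro exI[of _ ?\<iota>] exI[of _ ?\<pi>] conjI)
qed

lemma direct_sum_commute:
  assumes "is_direct_sum C S [X, Y]"
  shows "is_direct_sum C S [Y, X]"
  using assms
proof (rule direct_sum_two_cases)
  fix i p j q
  assume h: "i \<in> mor C X S" "p \<in> mor C S X" "j \<in> mor C Y S" "q \<in> mor C S Y"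
    "p \<cdot>\<^bsub>C\<^esub> i = ident C X" "q \<cdot>\<^bsub>C\<^esub> j = ident C Y"
    "q \<cdot>\<^bsub>C\<^esub> i = \<zero>\<^bsub>Hom C X Y\<^esub>" "p \<cdot>\<^bsub>C\<^esub> j = \<zero>\<^bsub>Hom C Y X\<^esub>"
    "ident C S = (i \<cdot>\<^bsub>C\<^esub> p) \<oplus>\<^bsub>Hom C S S\<^esub> (j \<cdot>\<^bsub>C\<^esub> q)"
  then have "ident C S = (j \<cdot>\<^bsub>C\<^esub> q) \<oplus>\<^bsub>Hom C S S\<^esub> (i \<cdot>\<^bsub>C\<^esub> p)"
    using add_commute comp_mor by metis
  then show ?thesis
    using h by (intro direct_sum_twoI[of j Y S q i X p])
qed

lemma no_maps_from_direct_sum: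
  assumes S: "is_direct_sum C S [X, Y]" and X: "no_maps C X W" and Y: "no_maps C Y W"
  shows "no_maps C S W"
proof (rule no_mapsI)
  fix f assume f: "f \<in> mor C S W"
  obtain i p j q where h: "i \<in> mor C X S" "p \<in> mor C S X" "j \<in> mor C Y S" "q \<in> mor C S Y"
    "ident C S = (i \<cdot>\<^bsub>C\<^esub> p) \<oplus>\<^bsub>Hom C S S\<^esub> (j \<cdot>\<^bsub>C\<^esub> q)"
    using direct_sum_two_cases[OF S] by metis
  have "f \<cdot>\<^bsub>C\<^esub> i = \<zero>\<^bsub>Hom C X W\<^esub>" "f \<cdot>\<^bsub>C\<^esub> j = \<zero>\<^bsub>Hom C Y W\<^esub>"
    using no_mapsD[OF X] no_mapsD[OF Y] comp_mor h f by blast+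
  then have "f \<cdot>\<^bsub>C\<^esub> (i \<cdot>\<^bsub>C\<^esub> p) = \<zero>\<^bsub>Hom C S W\<^esub>" "f \<cdot>\<^bsub>C\<^esub> (j \<cdot>\<^bsub>C\<^esub> q) = \<zero>\<^bsub>Hom C S W\<^esub>"
    using comp_assoc[OF h(2,1) f] comp_assoc[OF h(4,3) f] comp_zero_left h by auto
  then have "f \<cdot>\<^bsub>C\<^esub> ident C S = \<zero>\<^bsub>Hom C S W\<^esub>"
    unfolding h(5) using comp_add_right[OF _ _ f] comp_mor h by (simp add: add_zero zero_mor)
  then show "f = \<zero>\<^bsub>Hom C S W\<^esub>"
    using comp_ident_right[OF f] by simp
qed

lemma no_maps_to_direct_sum:
  assumes S: "is_direct_sum C S [X, Y]" and X: "no_maps C W X" and Y: "no_maps C W Y"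
  shows "no_maps C W S"
proof (rule no_mapsI)
  fix f assume f: "f \<in> mor C W S"
  obtain i p j q where h: "i \<in> mor C X S" "p \<in> mor C S X" "j \<in> mor C Y S" "q \<in> mor C S Y"
    "ident C S = (i \<cdot>\<^bsub>C\<^esub> p) \<oplus>\<^bsub>Hom C S S\<^esub> (j \<cdot>\<^bsub>C\<^esub> q)"
    using direct_sum_two_cases[OF S] by metis
  have "p \<cdot>\<^bsub>C\<^esub> f = \<zero>\<^bsub>Hom C W X\<^esub>" "q \<cdot>\<^bsub>C\<^esub> f = \<zero>\<^bsub>Hom C W Y\<^esub>"
    using no_mapsD[OF X] no_mapsD[OF Y] comp_mor h f by blast+
  then have "(i \<cdot>\<^bsub>C\<^esub> p) \<cdot>\<^bsub>C\<^esub> f = \<zero>\<^bsub>Hom C W S\<^esub>" "(j \<cdot>\<^bsub>C\<^esub> q) \<cdot>\<^bsub>C\<^esub> f = \<zero>\<^bsub>Hom C W S\<^esub>"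
    using comp_assoc[OF f h(2,1)] comp_assoc[OF f h(4,3)] comp_zero_right h by auto
  then have "ident C S \<cdot>\<^bsub>C\<^esub> f = \<zero>\<^bsub>Hom C W S\<^esub>"
    unfolding h(5) using comp_add_left[OF f] comp_mor h by (simp add: add_zero zero_mor)
  then show "f = \<zero>\<^bsub>Hom C W S\<^esub>"
    using comp_ident_left[OF f] by simp
qed

end


section \<open>The translation functor\<close>

context triangulated_category
begin

lemma shift_add_one: "shift C (i + 1) X = shift_ob C (shift C i X)"
proof (cases "i \<ge> 0")
  case True
  then show ?thesis by (simp add: shift_def nat_add_distrib)
next
  case False
  define n where "n = nat (- i - 1)"
  have i: "i = - int (Suc n)" using False by (simp add: n_def)
  have "shift C (i + 1) X = (inv_into UNIV (shift_ob C) ^^ n) X"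
    by (cases n) (auto simp: i shift_def nat_add_distrib)
  moreover have "shift C i X = inv_into UNIV (shift_ob C) ((inv_into UNIV (shift_ob C) ^^ n) X)"
    by (simp add: i shift_def nat_add_distrib)
  ultimately show ?thesis
    using surj_f_inv_f[OF bij_is_surj[OF shift_ob_bij]] by simp
qed

lemma shift_diff_one: "shift C (i - 1) X = inv_into UNIV (shift_ob C) (shift C i X)"
  using shift_add_one[of "i - 1" X] inv_f_f[OF bij_is_inj[OF shift_ob_bij]] by simp

lemma shift_zero: "shift C 0 X = X"
  by (simp add: shift_def)

lemma shift_one: "shift C 1 X = shift_ob C X"
  using shift_add_one[of 0] by (simp add: shift_zero)

lemma shift_shift: "shift C i (shift C j X) = shift C (i + j) X"
proof (induction i rule: int_induct[where k = 0])
  case base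
  show ?case by (simp add: shift_zero)
next
  case (step1 i)
  have "shift C (i + 1) (shift C j X) = shift C ((i + j) + 1) X"
    unfolding shift_add_one by (simp only: step1.IH)
  also have "(i + j) + 1 = (i + 1) + j" by simp
  finally show ?case .
next
  case (step2 i)
  have "shift C (i - 1) (shift C j X) = shift C ((i + j) - 1) X"
    unfolding shift_diff_one by (simp only: step2.IH)
  also have "(i + j) - 1 = (i - 1) + j" by simp
  finally show ?case .
qed

lemma shift_mor_mor: "f \<in> mor C X Y \<Longrightarrow> shift_mor C f \<in> mor C (shift_ob C X) (shift_ob C Y)"
  using bij_betwE[OF shift_mor_bij] by blast

lemma shift_mor_surj:
  assumes "f \<in> mor C (shift_ob C X) (shift_ob C Y)"
  obtains g where "g \<in> mor C X Y" "shift_mor C g = f"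
proof -
  have "f \<in> shift_mor C ` mor C X Y"
    using assms bij_betw_imp_surj_on[OF shift_mor_bij[of X Y]] by simp
  then show thesis using that by (elim imageE) simp
qed

lemma shift_mor_inj:
  "f \<in> mor C X Y \<Longrightarrow> g \<in> mor C X Y \<Longrightarrow> shift_mor C f = shift_mor C g \<Longrightarrow> f = g"
  by (rule inj_onD[OF bij_betw_imp_inj_on[OF shift_mor_bij]])

lemma shift_mor_zero:
  "shift_mor C \<zero>\<^bsub>Hom C X Y\<^esub> = \<zero>\<^bsub>Hom C (shift_ob C X) (shift_ob C Y)\<^esub>"
  using shift_add[OF zero_mor zero_mor]
  by (intro idempotent_add_zero shift_mor_mor zero_mor) (simp add: add_zero zero_mor)

lemma no_maps_shift_ob: "no_maps C (shift_ob C A) (shift_ob C B) \<longleftrightarrow> no_maps C A B"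
proof
  assume h: "no_maps C (shift_ob C A) (shift_ob C B)"
  show "no_maps C A B"
    using no_mapsD[OF h shift_mor_mor] shift_mor_inj shift_mor_zero zero_mor
    by (intro no_mapsI) metis
next
  assume h: "no_maps C A B"
  show "no_maps C (shift_ob C A) (shift_ob C B)"
    using no_mapsD[OF h] shift_mor_surj shift_mor_zero by (intro no_mapsI) metis
qed

lemma no_maps_shift_cancel: "no_maps C (shift C i A) (shift C i B) \<longleftrightarrow> no_maps C A B"
proof (induction i rule: int_induct[where k = 0])
  case base
  show ?case unfolding shift_zero ..
next
  case (step1 i)
  show ?case unfolding shift_add_one no_maps_shift_ob by (rule step1.IH)
next
  case (step2 i)
  have "shift C i X = shift_ob C (shift C (i - 1) X)" for X
    using shift_add_one[of "i - 1" X] by simp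
  with step2.IH
    have "no_maps C (shift_ob C (shift C (i - 1) A)) (shift_ob C (shift C (i - 1) B))
      \<longleftrightarrow> no_maps C A B"
    by (simp only:)
  then show ?case unfolding no_maps_shift_ob .
qed

lemma no_maps_shift_left: "no_maps C A (shift C i B) \<longleftrightarrow> no_maps C (shift C (- i) A) B"
  using no_maps_shift_cancel[of "- i" A "shift C i B"] by (simp add: shift_shift shift_zero)


section \<open>Exact sequences from triangles\<close>

lemma Tri_rotate:
  assumes "Tri C X Y Z f g h"
  shows "Tri C Y Z (shift_ob C X) g h
    (\<ominus>\<^bsub>Hom C (shift_ob C X) (shift_ob C Y)\<^esub> shift_mor C f)"
proof -
  have m: "f \<in> mor C X Y" "g \<in> mor C Y Z" "h \<in> mor C Z (shift_ob C X)"
    using Tri_mor[OF assms] by blast+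
  show ?thesis using assms TR2[OF m] by (rule iffD1[rotated])
qed

lemma Tri_comp_zero:
  assumes t: "Tri C X Y Z f g h"
  shows "g \<cdot>\<^bsub>C\<^esub> f = \<zero>\<^bsub>Hom C X Z\<^esub>"
proof -
  obtain N where N: "zero_object C N" using zero_object_exists by blast
  have m: "f \<in> mor C X Y" "g \<in> mor C Y Z" using Tri_mor[OF t] by auto
  obtain c where "c \<in> mor C N Z" "c \<cdot>\<^bsub>C\<^esub> \<zero>\<^bsub>Hom C X N\<^esub> = g \<cdot>\<^bsub>C\<^esub> f"
    using TR3[OF TR1_ident[OF N] t ident_mor m(1)] by blast
  then show ?thesis using comp_zero_right by metis
qed

text \<open>Compare the triangle with the triangle \<open>W \<rightarrow> 0 \<rightarrow> W[1]\<close>: a map \<open>\<phi>\<close> that \<open>g\<close> kills is the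
  first component of a morphism into the rotated triangle, whose third component is the shift of
  the lift.\<close>

lemma Tri_lift:
  assumes t: "Tri C X Y Z f g h" and \<phi>: "\<phi> \<in> mor C W Y" and z: "g \<cdot>\<^bsub>C\<^esub> \<phi> = \<zero>\<^bsub>Hom C W Z\<^esub>"
  obtains \<psi> where "\<psi> \<in> mor C W X" "f \<cdot>\<^bsub>C\<^esub> \<psi> = \<phi>"
proof -
  obtain N where N: "zero_object C N" using zero_object_exists by blast
  have m: "f \<in> mor C X Y" "g \<in> mor C Y Z" using Tri_mor[OF t] by auto
  let ?W = "shift_ob C W" and ?X = "shift_ob C X" and ?Y = "shift_ob C Y"
  have sq: "\<zero>\<^bsub>Hom C N Z\<^esub> \<cdot>\<^bsub>C\<^esub> \<zero>\<^bsub>Hom C W N\<^esub> = g \<cdot>\<^bsub>C\<^esub> \<phi>"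
    unfolding z by (rule comp_zero_left[OF zero_mor])
  obtain c where c: "c \<in> mor C ?W ?X"
    and c_eq: "shift_mor C \<phi> \<cdot>\<^bsub>C\<^esub> (\<ominus>\<^bsub>Hom C ?W ?W\<^esub> shift_mor C (ident C W))
        = (\<ominus>\<^bsub>Hom C ?X ?Y\<^esub> shift_mor C f) \<cdot>\<^bsub>C\<^esub> c"
    using TR3[OF Tri_rotate[OF TR1_ident[OF N]] Tri_rotate[OF t] \<phi> zero_mor sq] by blast
  obtain \<psi> where \<psi>: "\<psi> \<in> mor C W X" "shift_mor C \<psi> = c"
    by (rule shift_mor_surj[OF c])
  have f1: "shift_mor C f \<in> mor C ?X ?Y" and \<phi>1: "shift_mor C \<phi> \<in> mor C ?W ?Y"
    by (rule shift_mor_mor[OF m(1)], rule shift_mor_mor[OF \<phi>])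
  have "\<ominus>\<^bsub>Hom C ?W ?Y\<^esub> shift_mor C \<phi>
      = shift_mor C \<phi> \<cdot>\<^bsub>C\<^esub> (\<ominus>\<^bsub>Hom C ?W ?W\<^esub> shift_mor C (ident C W))"
    unfolding shift_ident comp_neg_right[OF ident_mor \<phi>1] comp_ident_right[OF \<phi>1] ..
  also note c_eq
  also note comp_neg_left[OF c f1]
  finally have "shift_mor C \<phi> = shift_mor C f \<cdot>\<^bsub>C\<^esub> c"
    by (rule neg_inj[OF \<phi>1 comp_mor[OF c f1]])
  also have "\<dots> = shift_mor C (f \<cdot>\<^bsub>C\<^esub> \<psi>)"
    unfolding \<psi>(2)[symmetric] by (rule shift_comp[OF \<psi>(1) m(1), symmetric])
  finally have "\<phi> = f \<cdot>\<^bsub>C\<^esub> \<psi>"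
    by (rule shift_mor_inj[OF \<phi> comp_mor[OF \<psi>(1) m(1)]])
  then show thesis using that[OF \<psi>(1)] by simp
qed

text \<open>Dually, the extension is the third component of a morphism to the triangle
  \<open>0 \<rightarrow> W \<rightarrow> W\<close>.\<close>

lemma Tri_extend:
  assumes t: "Tri C X Y Z f g h" and \<phi>: "\<phi> \<in> mor C Y W" and z: "\<phi> \<cdot>\<^bsub>C\<^esub> f = \<zero>\<^bsub>Hom C X W\<^esub>"
  obtains \<psi> where "\<psi> \<in> mor C Z W" "\<psi> \<cdot>\<^bsub>C\<^esub> g = \<phi>"
proof -
  obtain N' where N': "zero_object C N'" using zero_object_exists by blast
  obtain N where N: "N' = shift_ob C N" using bij_pointE[OF shift_ob_bij] by blast
  have t': "Tri C N W W \<zero>\<^bsub>Hom C N W\<^esub> (ident C W) \<zero>\<^bsub>Hom C W (shift_ob C N)\<^esub>"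
    using TR1_ident[OF N'[unfolded N], of W]
    by (intro iffD2[OF TR2[OF zero_mor ident_mor zero_mor]]) (simp add: shift_mor_zero neg_zero)
  have sq: "\<phi> \<cdot>\<^bsub>C\<^esub> f = \<zero>\<^bsub>Hom C N W\<^esub> \<cdot>\<^bsub>C\<^esub> \<zero>\<^bsub>Hom C X N\<^esub>"
    unfolding z by (rule comp_zero_left[OF zero_mor, symmetric])
  obtain c where "c \<in> mor C Z W" "c \<cdot>\<^bsub>C\<^esub> g = ident C W \<cdot>\<^bsub>C\<^esub> \<phi>"
    using TR3[OF t t' zero_mor \<phi> sq] by blast
  then show thesis using that comp_ident_left[OF \<phi>] by simp
qed

lemma no_maps_to_Tri:
  assumes t: "Tri C X Y Z f g h" and X: "no_maps C W X" and Z: "no_maps C W Z"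
  shows "no_maps C W Y"
proof (rule no_mapsI)
  fix \<phi> assume \<phi>: "\<phi> \<in> mor C W Y"
  have m: "f \<in> mor C X Y" "g \<in> mor C Y Z" using Tri_mor[OF t] by auto
  obtain \<psi> where "\<psi> \<in> mor C W X" "f \<cdot>\<^bsub>C\<^esub> \<psi> = \<phi>"
    using Tri_lift[OF t \<phi> no_mapsD[OF Z comp_mor[OF \<phi> m(2)]]] by blast
  then show "\<phi> = \<zero>\<^bsub>Hom C W Y\<^esub>"
    using no_mapsD[OF X] comp_zero_right[OF m(1)] by metis
qed

lemma no_maps_from_Tri:
  assumes t: "Tri C X Y Z f g h" and X: "no_maps C X W" and Z: "no_maps C Z W"
  shows "no_maps C Y W"
proof (rule no_mapsI)
  fix \<phi> assume \<phi>: "\<phi> \<in> mor C Y W"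
  have m: "f \<in> mor C X Y" "g \<in> mor C Y Z" using Tri_mor[OF t] by auto
  obtain \<psi> where "\<psi> \<in> mor C Z W" "\<psi> \<cdot>\<^bsub>C\<^esub> g = \<phi>"
    using Tri_extend[OF t \<phi> no_mapsD[OF X comp_mor[OF m(1) \<phi>]]] by blast
  then show "\<phi> = \<zero>\<^bsub>Hom C Y W\<^esub>"
    using no_mapsD[OF Z] comp_zero_left[OF m(2)] by metis
qed

text \<open>A morphism \<open>U \<rightarrow> X[1]\<close> classifies an extension of \<open>U\<close> by \<open>X\<close>: the middle term is the
  desuspended cone, and the triangle of the cone is rotated back twice. The maps \<open>f\<close> and \<open>g\<close> are
  chosen with signs that cancel those of the two rotations.\<close>

lemma Tri_from_connecting_morphism:
  assumes h: "h \<in> mor C U (shift_ob C X)"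
  obtains Y f g where "Tri C X Y U f g h"
proof -
  obtain Y' p q where t: "Tri C U (shift_ob C X) Y' h p q" using TR1_cone[OF h] by blast
  obtain Y where Y: "Y' = shift_ob C Y" using bij_pointE[OF shift_ob_bij] by blast
  have m: "p \<in> mor C (shift_ob C X) (shift_ob C Y)" "q \<in> mor C (shift_ob C Y) (shift_ob C U)"
    using Tri_mor[OF t] Y by auto
  obtain f where f: "f \<in> mor C X Y"
    "shift_mor C f = \<ominus>\<^bsub>Hom C (shift_ob C X) (shift_ob C Y)\<^esub> p"
    by (rule shift_mor_surj[OF neg_mor[OF m(1)]])
  obtain g where g: "g \<in> mor C Y U"
    "shift_mor C g = \<ominus>\<^bsub>Hom C (shift_ob C Y) (shift_ob C U)\<^esub> q"
    by (rule shift_mor_surj[OF neg_mor[OF m(2)]])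
  have "Tri C Y U (shift_ob C X) g h p"
    using TR2[OF g(1) h m(1)] t Y g(2) neg_neg_mor[OF m(2)] by simp
  then have "Tri C X Y U f g h"
    using TR2[OF f(1) g(1) h] f(2) neg_neg_mor[OF m(1)] by simp
  then show thesis by (rule that)
qed

end


section \<open>Iterated extensions\<close>

text \<open>The objects obtained from \<open>S\<close> by finitely many extensions by copies of \<open>U\<close>, that is the
  members of \<open>S * U * \<dots> * U\<close>.\<close>

inductive iterated_extension ::
  "('k, 'o, 'm, 'z) triangulated_cat_scheme \<Rightarrow> 'o \<Rightarrow> 'o \<Rightarrow> 'o \<Rightarrow> bool"
  for C :: "('k, 'o, 'm, 'z) triangulated_cat_scheme" and S U :: 'o where
  base: "iterated_extension C S U S"
| extend: "iterated_extension C S U X \<Longrightarrow> Tri C X Y U f g h \<Longrightarrow> iterated_extension C S U Y"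

context triangulated_category
begin

lemma no_maps_from_iterated_extension:
  assumes "iterated_extension C S U X" "no_maps C S W" "no_maps C U W"
  shows "no_maps C X W"
  using assms by (induction rule: iterated_extension.induct) (auto intro: no_maps_from_Tri)

text \<open>Moving the shift to the first argument makes it possible to use the defining triangles as
  they are, without shifting them.\<close>

lemma no_maps_to_iterated_extension:
  assumes "iterated_extension C S U X" "no_maps C W (shift C i S)" "no_maps C W (shift C i U)"
  shows "no_maps C W (shift C i X)"
  using assms unfolding no_maps_shift_left
  by (induction rule: iterated_extension.induct) (auto intro: no_maps_to_Tri)

lemma thick_subcategory_first_vertex:
  assumes S: "thick_subcategory C \<S>" and t: "Tri C X Y Z f g h" and "Y \<in> \<S>" "Z \<in> \<S>"
  shows "X \<in> \<S>"
proof -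
  have "shift_ob C X \<in> \<S>"
    using S Tri_rotate[OF t] assms(3,4) unfolding thick_subcategory_def by blast
  then have "shift C (-1) (shift_ob C X) \<in> \<S>"
    using S unfolding thick_subcategory_def by blast
  then show ?thesis
    using shift_shift[of "-1" 1 X] by (simp add: shift_one shift_zero)
qed

lemma thick_subcategory_iterated_extension:
  assumes "iterated_extension C S U X" "thick_subcategory C \<S>" "X \<in> \<S>" "U \<in> \<S>"
  shows "S \<in> \<S>"
  using assms
  by (induction rule: iterated_extension.induct) (auto intro: thick_subcategory_first_vertex)

text \<open>Extending \<open>X\<close> along \<open>q[1] b\<close> kills that map, and as there are no maps \<open>U \<rightarrow> U[1]\<close> it
  creates no new maps from \<open>U\<close> to the shifted object. So the maps can be killed one after
  another, all remaining ones still coming from \<open>S[1]\<close>.\<close>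

lemma iterated_extension_killing_maps:
  assumes U: "no_maps C U (shift_ob C U)"
    and "finite B" "B \<subseteq> mor C U (shift_ob C S)"
  shows "\<exists>X q. iterated_extension C S U X \<and> q \<in> mor C S X \<and>
    (\<forall>b \<in> B. shift_mor C q \<cdot>\<^bsub>C\<^esub> b = \<zero>\<^bsub>Hom C U (shift_ob C X)\<^esub>) \<and>
    (\<forall>\<psi> \<in> mor C U (shift_ob C X). \<exists>\<chi> \<in> mor C U (shift_ob C S). shift_mor C q \<cdot>\<^bsub>C\<^esub> \<chi> = \<psi>)"
  using assms(2,3)
proof (induction B rule: finite_induct)
  case empty
  have "\<exists>\<chi> \<in> mor C U (shift_ob C S). shift_mor C (ident C S) \<cdot>\<^bsub>C\<^esub> \<chi> = \<psi>"
    if "\<psi> \<in> mor C U (shift_ob C S)" for \<psi>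
    using that comp_ident_left by (auto simp: shift_ident)
  then show ?case
    using iterated_extension.base[of C S U] ident_mor[of S] by blast
next
  case (insert b B)
  then obtain X q where X: "iterated_extension C S U X" and q: "q \<in> mor C S X"
    and kill: "\<And>b. b \<in> B \<Longrightarrow> shift_mor C q \<cdot>\<^bsub>C\<^esub> b = \<zero>\<^bsub>Hom C U (shift_ob C X)\<^esub>"
    and onto: "\<And>\<psi>. \<psi> \<in> mor C U (shift_ob C X) \<Longrightarrow>
      \<exists>\<chi> \<in> mor C U (shift_ob C S). shift_mor C q \<cdot>\<^bsub>C\<^esub> \<chi> = \<psi>"
    by (metis insert_subset)
  have B: "b \<in> mor C U (shift_ob C S)" "\<And>b'. b' \<in> B \<Longrightarrow> b' \<in> mor C U (shift_ob C S)"
    using insert.prems by auto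
  define h where "h = shift_mor C q \<cdot>\<^bsub>C\<^esub> b"
  have q1: "shift_mor C q \<in> mor C (shift_ob C S) (shift_ob C X)"
    using shift_mor_mor[OF q] .
  have h: "h \<in> mor C U (shift_ob C X)"
    unfolding h_def using comp_mor[OF B(1) q1] .
  obtain Y f g where t: "Tri C X Y U f g h"
    using Tri_from_connecting_morphism[OF h] by blast
  have fg: "f \<in> mor C X Y" "g \<in> mor C Y U" using Tri_mor[OF t] by auto
  have f1: "shift_mor C f \<in> mor C (shift_ob C X) (shift_ob C Y)"
    and g1: "shift_mor C g \<in> mor C (shift_ob C Y) (shift_ob C U)"
    using shift_mor_mor fg by blast+
  let ?q = "f \<cdot>\<^bsub>C\<^esub> q"
  have q_comp: "shift_mor C ?q \<cdot>\<^bsub>C\<^esub> \<chi> = shift_mor C f \<cdot>\<^bsub>C\<^esub> (shift_mor C q \<cdot>\<^bsub>C\<^esub> \<chi>)"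
    if "\<chi> \<in> mor C U (shift_ob C S)" for \<chi>
    using comp_assoc[OF that q1 f1] shift_comp[OF q fg(1)] by simp
  \<comment> \<open>The rotated triangle \<open>U \<rightarrow> X[1] \<rightarrow> Y[1] \<rightarrow> U[1]\<close> starts with \<open>h\<close>: consecutive maps compose to
    zero, so \<open>h\<close> dies in \<open>Y[1]\<close>, and by exactness at \<open>Y[1]\<close> each map \<open>U \<rightarrow> Y[1]\<close> comes from
    \<open>X[1]\<close>.\<close>
  note t' = Tri_rotate[OF Tri_rotate[OF t]]
  have "\<ominus>\<^bsub>Hom C U (shift_ob C Y)\<^esub> (shift_mor C f \<cdot>\<^bsub>C\<^esub> h) = \<zero>\<^bsub>Hom C U (shift_ob C Y)\<^esub>"
    using Tri_comp_zero[OF t'] comp_neg_left[OF h f1] by simp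
  then have "shift_mor C f \<cdot>\<^bsub>C\<^esub> h = \<zero>\<^bsub>Hom C U (shift_ob C Y)\<^esub>"
    by (rule neg_eq_zero[OF comp_mor[OF h f1]])
  then have kills: "shift_mor C ?q \<cdot>\<^bsub>C\<^esub> b' = \<zero>\<^bsub>Hom C U (shift_ob C Y)\<^esub>" if "b' \<in> insert b B" for b'
    using that q_comp B kill comp_zero_right[OF f1] unfolding h_def by auto
  have "\<exists>\<chi> \<in> mor C U (shift_ob C S). shift_mor C ?q \<cdot>\<^bsub>C\<^esub> \<chi> = \<psi>"
    if \<psi>: "\<psi> \<in> mor C U (shift_ob C Y)" for \<psi>
  proof -
    have "(\<ominus>\<^bsub>Hom C (shift_ob C Y) (shift_ob C U)\<^esub> shift_mor C g) \<cdot>\<^bsub>C\<^esub> \<psi>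
        = \<zero>\<^bsub>Hom C U (shift_ob C U)\<^esub>"
      using no_mapsD[OF U comp_mor[OF \<psi> neg_mor[OF g1]]] .
    then obtain \<psi>' where \<psi>': "\<psi>' \<in> mor C U (shift_ob C X)"
      "(\<ominus>\<^bsub>Hom C (shift_ob C X) (shift_ob C Y)\<^esub> shift_mor C f) \<cdot>\<^bsub>C\<^esub> \<psi>' = \<psi>"
      using Tri_lift[OF Tri_rotate[OF t'] \<psi>] by blast
    then have "shift_mor C f \<cdot>\<^bsub>C\<^esub> (\<ominus>\<^bsub>Hom C U (shift_ob C X)\<^esub> \<psi>') = \<psi>"
      using comp_neg_left[OF \<psi>'(1) f1] comp_neg_right[OF \<psi>'(1) f1] by simp
    then show ?thesis
      using onto[OF neg_mor[OF \<psi>'(1)]] q_comp by metis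
  qed
  then show ?case
    using iterated_extension.extend[OF X t] comp_mor[OF q fg(1)] kills by blast
qed

text \<open>Killing a finite spanning set of \<open>Hom(U, S[1])\<close> leaves nothing: every map \<open>U \<rightarrow> X[1]\<close> is the
  image of a map \<open>U \<rightarrow> S[1]\<close>, hence of a linear combination of killed ones.\<close>

lemma iterated_extension_no_maps:
  assumes fin: "finite_dimensional K (Hom C U (shift_ob C S))"
    and U: "no_maps C U (shift_ob C U)"
  obtains X where "iterated_extension C S U X" "no_maps C U (shift_ob C X)"
proof -
  obtain B where B: "finite B" "B \<subseteq> mor C U (shift_ob C S)"
    and span: "\<And>x. x \<in> mor C U (shift_ob C S) \<Longrightarrow> \<exists>c \<in> B \<rightarrow> carrier K.
      x = (\<Oplus>\<^bsub>Hom C U (shift_ob C S)\<^esub>b\<in>B. c b \<odot>\<^bsub>Hom C U (shift_ob C S)\<^esub> b)"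
    using fin unfolding finite_dimensional_def by blast
  obtain X q where X: "iterated_extension C S U X" and q: "q \<in> mor C S X"
    and kill: "\<forall>b \<in> B. shift_mor C q \<cdot>\<^bsub>C\<^esub> b = \<zero>\<^bsub>Hom C U (shift_ob C X)\<^esub>"
    and onto: "\<forall>\<psi> \<in> mor C U (shift_ob C X).
      \<exists>\<chi> \<in> mor C U (shift_ob C S). shift_mor C q \<cdot>\<^bsub>C\<^esub> \<chi> = \<psi>"
    using iterated_extension_killing_maps[OF U B] by blast
  have "no_maps C U (shift_ob C X)"
  proof (rule no_mapsI)
    fix \<psi> assume "\<psi> \<in> mor C U (shift_ob C X)"
    then obtain \<chi> where \<chi>: "\<chi> \<in> mor C U (shift_ob C S)" "shift_mor C q \<cdot>\<^bsub>C\<^esub> \<chi> = \<psi>"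
      using onto by blast
    obtain c where "c \<in> B \<rightarrow> carrier K"
      "\<chi> = (\<Oplus>\<^bsub>Hom C U (shift_ob C S)\<^esub>b\<in>B. c b \<odot>\<^bsub>Hom C U (shift_ob C S)\<^esub> b)"
      using span[OF \<chi>(1)] by blast
    then show "\<psi> = \<zero>\<^bsub>Hom C U (shift_ob C X)\<^esub>"
      using comp_linear_combination_zero[OF B _ shift_mor_mor[OF q]] kill \<chi>(2) by blast
  qed
  then show thesis using that X by blast
qed


section \<open>Bongartz completion\<close>

lemma silting_geq_iff: "silting_geq C M N \<longleftrightarrow> (\<forall>i>0. no_maps C M (shift C i N))"
  by (simp add: silting_geq_def no_maps_def)

lemma presilting_iff: "presilting C M \<longleftrightarrow> silting_geq C M M"
  by (simp add: presilting_def silting_geq_def)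

lemma silting_geq_from_direct_sum:
  "is_direct_sum C P [X, Y] \<Longrightarrow> silting_geq C X N \<Longrightarrow> silting_geq C Y N \<Longrightarrow> silting_geq C P N"
  unfolding silting_geq_iff by (meson no_maps_from_direct_sum)

lemma silting_geq_to_direct_sum:
  "is_direct_sum C P [X, Y] \<Longrightarrow> silting_geq C M X \<Longrightarrow> silting_geq C M Y \<Longrightarrow> silting_geq C M P"
  unfolding silting_geq_iff no_maps_shift_left by (meson no_maps_to_direct_sum)

lemma silting_geq_shift: "silting_geq C (shift C j M) (shift C j N) \<longleftrightarrow> silting_geq C M N"
proof -
  have "no_maps C (shift C j M) (shift C i (shift C j N)) \<longleftrightarrow> no_maps C M (shift C i N)" for i
    using no_maps_shift_cancel[of j M "shift C i N"] by (simp add: shift_shift add.commute)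
  then show ?thesis by (simp add: silting_geq_iff)
qed

lemma silting_shift:
  assumes "silting C T"
  shows "silting C (shift C (-1) T)"
proof -
  have "X \<in> \<S>" if \<S>: "thick_subcategory C \<S>" "shift C (-1) T \<in> \<S>" for X \<S>
  proof -
    have "shift C 1 (shift C (-1) T) \<in> \<S>"
      using \<S> unfolding thick_subcategory_def by blast
    then have "T \<in> \<S>" by (simp add: shift_shift shift_zero)
    then show ?thesis
      using assms \<S>(1) unfolding silting_def thick_def by blast
  qed
  then show ?thesis
    using assms by (auto simp: silting_def thick_def presilting_iff silting_geq_shift)
qed

text \<open>The complement is an iterated extension \<open>X\<close> of \<open>S\<close> by \<open>U\<close> with no maps \<open>U \<rightarrow> X[1]\<close>; that
  one degree is the only one which devissage does not settle, because \<open>Hom(U, S[1])\<close> need not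
  vanish.\<close>

theorem bongartz_completion:
  assumes fin: "finite_dimensional K (Hom C U (shift_ob C S))"
    and S: "silting C S" and U: "presilting C U"
    and SU: "silting_geq C S U" and US: "silting_geq C U (shift C 1 S)"
  shows "partial_silting C U"
proof -
  have U1: "no_maps C U (shift_ob C U)"
    using U[unfolded presilting_iff silting_geq_iff, rule_format, of 1] by (simp add: shift_one)
  obtain X where X: "iterated_extension C S U X" and UX1: "no_maps C U (shift_ob C X)"
    using iterated_extension_no_maps[OF fin U1] by blast
  have SX: "silting_geq C S X"
    using S SU no_maps_to_iterated_extension[OF X]
    by (simp add: silting_def presilting_iff silting_geq_iff)
  have UX: "silting_geq C U X"
    unfolding silting_geq_iff
  proof (intro allI impI)
    fix i :: int assume "i > 0"
    show "no_maps C U (shift C i X)"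
    proof (cases "i = 1")
      case True
      then show ?thesis using UX1 by (simp add: shift_one)
    next
      case False
      then have "i - 1 > 0" using \<open>i > 0\<close> by simp
      then have "no_maps C U (shift C (i - 1) (shift C 1 S))"
        using US unfolding silting_geq_iff by blast
      then have "no_maps C U (shift C i S)" by (simp add: shift_shift)
      moreover have "no_maps C U (shift C i U)"
        using U \<open>i > 0\<close> unfolding presilting_iff silting_geq_iff by blast
      ultimately show ?thesis by (rule no_maps_to_iterated_extension[OF X])
    qed
  qed
  have XX: "silting_geq C X X" and XU: "silting_geq C X U"
    using SX UX SU U no_maps_from_iterated_extension[OF X]
    by (simp_all add: presilting_iff silting_geq_iff)
  obtain P where P: "is_direct_sum C P [U, X]" using direct_sum_exists by blast
  have "presilting C P"
    unfolding presilting_iff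
    using U XX XU UX unfolding presilting_iff
    by (intro silting_geq_from_direct_sum[OF P] silting_geq_to_direct_sum[OF P])
  moreover have "Y \<in> \<S>" if \<S>: "thick_subcategory C \<S>" "P \<in> \<S>" for Y \<S>
  proof -
    have "U \<in> \<S>" "X \<in> \<S>"
      using \<S> P direct_sum_commute[OF P] unfolding thick_subcategory_def direct_summand_def
      by blast+
    then have "S \<in> \<S>"
      using thick_subcategory_iterated_extension[OF X \<S>(1)] by blast
    then show ?thesis
      using S \<S>(1) unfolding silting_def thick_def by blast
  qed
  ultimately have "silting C P" by (auto simp: silting_def thick_def)
  then show ?thesis
    using P unfolding partial_silting_def direct_summand_def by blast
qed

end

theorem proposition2p16:
  fixes K :: "('k, 'r) ring_scheme"
    and C :: "('k, 'o, 'm, 'z) triangulated_cat_scheme"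
    and T U :: 'o
  assumes "field K"
    and "triangulated_category K C"
    and "hom_finite K C"
    and "krull_schmidt C"
    and "silting C T"
    and "basic_object C T"
    and "presilting C U"
    and "silting_geq C (shift C (-1) T) U"
    and "silting_geq C U T"
  shows "partial_silting C U"
proof -
  interpret triangulated_category K C by fact
  show ?thesis
  proof (rule bongartz_completion)
    show "finite_dimensional K (Hom C U (shift_ob C (shift C (-1) T)))"
      using assms(3) by (simp add: hom_finite_def)
    show "silting C (shift C (-1) T)" using assms(5) by (rule silting_shift)
    show "silting_geq C U (shift C 1 (shift C (-1) T))"
      using assms(9) by (simp add: shift_shift shift_zero)
  qed (fact assms)+
qed

end
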